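(* Let $(X,\sigma)$ be a DR system on a compact metric space $(X,d)$ with $\operatorname{Dom}(\sigma)$ clopen in $X$, let $\Omega$ be its nonwandering set, and let $(\Omega,\sigma_{|_\Omega})$ be the restricted DR system. Then $h_d(\sigma)=h_d(\sigma_{|_\Omega})$.
   Context: A DR (Deaconu-Renault) system $(X,\sigma)$ consists of a locally compact Hausdorff space $X$ and a local homeomorphism $\sigma:\operatorname{Dom}(\sigma)\to\operatorname{Im}(\sigma)$ from an open set $\operatorname{Dom}(\sigma)\subseteq X$ onto an open set $\operatorname{Im}(\sigma)\subseteq X$. Iterates $\sigma^n$ are compositions of the partially defined map $\sigma$ on their natural domains $\operatorname{Dom}(\sigma^n)$, with $\sigma^0=\mathrm{id}$ and $\operatorname{Dom}(\sigma^0)=X$. $\mathbb{N}=\{1,2,\dots\}$. For any $Y\subseteq X$ and $n\ge 0$, $\sigma^n(Y)$ means $\sigma^n(Y\cap\operatorname{Dom}(\sigma^n))$; for $k<0$, $\sigma^k(Y)=\{x\in\operatorname{Dom}(\sigma^{-k}):\sigma^{-k}(x)\in Y\}$. A point $x\in X$ is wandering if there is an open neighborhood $U$ of $x$ with $\sigma^n(U)\cap\sigma^{-k}(\sigma^k(U))=\emptyset$ for all $n\ge1$ and all $k\in\mathbb{Z}$; otherwise $x$ is nonwandering. $\Omega$ denotes the set of nonwandering points. For $Y\subseteq X$ with $\sigma(\operatorname{Dom}(\sigma)\cap Y)$ an open subset of $Y$ (induced topology), the restricted DR system $(Y,\sigma_{|_Y})$ is given by the restriction of $\sigma$ to $Y$,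 with $\operatorname{Dom}(\sigma_{|_Y})=\operatorname{Dom}(\sigma)\cap Y$ and $\operatorname{Im}(\sigma_{|_Y})=\sigma(\operatorname{Dom}(\sigma)\cap Y)$. (The set $\Omega$ satisfies this.) Its entropy is computed by the definitions below applied to $(Y,\sigma_{|_Y})$ with the metric $d$ restricted to $Y$ (compact sets $K\subseteq Y$, closed sets $F$ relative to $Y$). Entropy: let $d$ be the metric of $X$. For $x\in X$, $n\in\mathbb{N}$, let $I_n(x)=\{i\in\{0,\dots,n-1\}:x\in\operatorname{Dom}(\sigma^i)\}$ and $d_n(x,y)=\max_{i\in I_n(x)\cap I_n(y)}d(\sigma^i(x),\sigma^i(y))$. For $K\subseteq X$ compact, $Y\subseteq X$ and $\varepsilon>0$, a set $A\subseteq K\cap Y$ is $(n,\varepsilon,\sigma,K\cap Y)$-separated if $d_n(x,y)>\varepsilon$ for all distinct $x,y\in A$; $\mathrm{sep}(n,\varepsilon,\sigma,K\cap Y)$ is the largest cardinality of such a set. Put $\mathrm{ssep}(n,\varepsilon,\sigma,K)=\sup_F\mathrm{sep}(n,\varepsilon,\sigma,K\cap F)$, the supremum over all closed sets $F\subseteq X$ with $F\subseteq\operatorname{Dom}(\sigma^{n-1})$. Then $h_\varepsilon(\sigma,K,d)=\limsup_{n\to\infty}\frac1n\log\mathrm{ssep}(n,\varepsilon,\sigma,K)$, $h_d(\sigma,K)=\lim_{\varepsilon\to0}h_\varepsilon(\sigma,K,d)$, and $h_d(\sigma)=\sup_K h_d(\sigma,K)$ over all compact $K\subseteq X$. Values are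 extended real numbers, with $\log 0=-\infty$ and $\log\infty=\infty$. *)

theory Defs
  imports "HOL-Analysis.Analysis"
begin

text \<open>
  A partially defined map on a space is given by its carrier \<open>X\<close>, its domain \<open>D \<subseteq> X\<close> and a
  function \<open>f\<close> whose values outside \<open>D\<close> are irrelevant. Topological notions are relative to the
  carrier. The restriction to \<open>Y \<subseteq> X\<close>, where \<open>f ` (D \<inter> Y)\<close> is open in \<open>Y\<close>, is again such a
  triple, namely \<open>Y\<close>, \<open>D \<inter> Y\<close>, \<open>f\<close>; its iterates, metrics and entropy are formed within \<open>Y\<close>.
\<close>

definition local_homeomorphism_onto ::
    "('a::topological_space) set \<Rightarrow> ('b::topological_space) set \<Rightarrow> ('a \<Rightarrow> 'b) \<Rightarrow> bool" where
  "local_homeomorphism_onto S T f \<longleftrightarrow> f ` S = T \<and>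
     (\<forall>x\<in>S. \<exists>U. x \<in> U \<and> openin (top_of_set S) U \<and> openin (top_of_set T) (f ` U) \<and>
        (\<exists>g. homeomorphism U (f ` U) f g))"

text \<open>The Hausdorff property is provided by the type class.\<close>

definition dr_system :: "('a::t2_space) set \<Rightarrow> 'a set \<Rightarrow> ('a \<Rightarrow> 'a) \<Rightarrow> bool" where
  "dr_system X D f \<longleftrightarrow> locally compact X \<and> openin (top_of_set X) D \<and>
     openin (top_of_set X) (f ` D) \<and> local_homeomorphism_onto D (f ` D) f"

text \<open>\<open>dom_iter X D f n\<close> is the natural domain of the \<open>n\<close>-th iterate; on it, the iterate
  is \<open>f ^^ n\<close>.\<close>

primrec dom_iter :: "'a set \<Rightarrow> 'a set \<Rightarrow> ('a \<Rightarrow> 'a) \<Rightarrow> nat \<Rightarrow> 'a set" where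
  "dom_iter X D f 0 = X"
| "dom_iter X D f (Suc n) = {x \<in> D. f x \<in> dom_iter X D f n}"

definition iter_image :: "'a set \<Rightarrow> 'a set \<Rightarrow> ('a \<Rightarrow> 'a) \<Rightarrow> int \<Rightarrow> 'a set \<Rightarrow> 'a set" where
  "iter_image X D f k Y =
     (if 0 \<le> k then (f ^^ nat k) ` (Y \<inter> dom_iter X D f (nat k))
      else {x \<in> dom_iter X D f (nat (- k)). (f ^^ nat (- k)) x \<in> Y})"

definition wandering ::
    "('a::topological_space) set \<Rightarrow> 'a set \<Rightarrow> ('a \<Rightarrow> 'a) \<Rightarrow> 'a \<Rightarrow> bool" where
  "wandering X D f x \<longleftrightarrow>
     (\<exists>U. openin (top_of_set X) U \<and> x \<in> U \<and>
        (\<forall>n::nat. \<forall>k::int. 1 \<le> n \<longrightarrow>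
           iter_image X D f (int n) U \<inter> iter_image X D f (- k) (iter_image X D f k U) = {}))"

definition nonwandering_set ::
    "('a::topological_space) set \<Rightarrow> 'a set \<Rightarrow> ('a \<Rightarrow> 'a) \<Rightarrow> 'a set" where
  "nonwandering_set X D f = {x \<in> X. \<not> wandering X D f x}"

definition dist_iter ::
    "('a::metric_space) set \<Rightarrow> 'a set \<Rightarrow> ('a \<Rightarrow> 'a) \<Rightarrow> nat \<Rightarrow> 'a \<Rightarrow> 'a \<Rightarrow> real" where
  "dist_iter X D f n x y =
     Max {dist ((f ^^ i) x) ((f ^^ i) y) | i. i < n \<and> x \<in> dom_iter X D f i \<and> y \<in> dom_iter X D f i}"

definition separated ::
    "('a::metric_space) set \<Rightarrow> 'a set \<Rightarrow> ('a \<Rightarrow> 'a) \<Rightarrow> nat \<Rightarrow> real \<Rightarrow> 'a set \<Rightarrow> 'a set \<Rightarrow> bool" where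
  "separated X D f n \<epsilon> S A \<longleftrightarrow>
     A \<subseteq> S \<and> (\<forall>x\<in>A. \<forall>y\<in>A. x \<noteq> y \<longrightarrow> \<epsilon> < dist_iter X D f n x y)"

definition enat_card :: "'a set \<Rightarrow> enat" where
  "enat_card A = (if finite A then enat (card A) else \<infinity>)"

definition sep ::
    "('a::metric_space) set \<Rightarrow> 'a set \<Rightarrow> ('a \<Rightarrow> 'a) \<Rightarrow> nat \<Rightarrow> real \<Rightarrow> 'a set \<Rightarrow> enat" where
  "sep X D f n \<epsilon> S = (SUP A\<in>{A. separated X D f n \<epsilon> S A}. enat_card A)"

definition ssep ::
    "('a::metric_space) set \<Rightarrow> 'a set \<Rightarrow> ('a \<Rightarrow> 'a) \<Rightarrow> nat \<Rightarrow> real \<Rightarrow> 'a set \<Rightarrow> enat" where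
  "ssep X D f n \<epsilon> K =
     (SUP F\<in>{F. closedin (top_of_set X) F \<and> F \<subseteq> dom_iter X D f (n - 1)}. sep X D f n \<epsilon> (K \<inter> F))"

definition log_enat :: "enat \<Rightarrow> ereal" where
  "log_enat m = (case m of enat k \<Rightarrow> if k = 0 then -\<infinity> else ereal (ln (real k)) | \<infinity> \<Rightarrow> \<infinity>)"

text \<open>Only indices \<open>n \<ge> 1\<close> are meaningful; the value at \<open>n = 0\<close> does not affect the limit superior.\<close>

definition entropy_eps ::
    "('a::metric_space) set \<Rightarrow> 'a set \<Rightarrow> ('a \<Rightarrow> 'a) \<Rightarrow> real \<Rightarrow> 'a set \<Rightarrow> ereal" where
  "entropy_eps X D f \<epsilon> K = limsup (\<lambda>n. ereal (1 / real n) * log_enat (ssep X D f n \<epsilon> K))"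

definition entropy_on ::
    "('a::metric_space) set \<Rightarrow> 'a set \<Rightarrow> ('a \<Rightarrow> 'a) \<Rightarrow> 'a set \<Rightarrow> ereal" where
  "entropy_on X D f K = Lim (at_right 0) (\<lambda>\<epsilon>. entropy_eps X D f \<epsilon> K)"

definition dr_entropy :: "('a::metric_space) set \<Rightarrow> 'a set \<Rightarrow> ('a \<Rightarrow> 'a) \<Rightarrow> ereal" where
  "dr_entropy X D f = (SUP K\<in>{K. K \<subseteq> X \<and> compact K}. entropy_on X D f K)"

end

theory Submission
  imports Defs "HOL-Real_Asymp.Real_Asymp"
begin

text \<open>
  The map \<open>\<sigma>\<close> is continuous, the domains \<open>D\<^sub>n\<close> of its iterates are clopen, and a wandering point
  has a neighbourhood to which no orbit starting in it ever returns. Hence an orbit meets a fixed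
  small wandering set at most once, so the time that it spends away from \<open>\<Omega>\<close> contributes only a
  polynomial factor to the number of distinguishable orbits, and entropy does not see it. This is
  Bowen's argument for homeomorphisms, adapted to orbits that may leave the domain.

  In detail, fix a scale \<open>\<epsilon>\<close> and a block length \<open>n\<close>, and let \<open>E\<close> be a maximal \<open>(n, \<epsilon>)\<close>-separated set
  of points of \<open>\<Omega>\<close> whose orbits survive for \<open>n\<close> times, of cardinality \<open>s\<close>. The open Bowen balls of
  radius \<open>2\<epsilon>\<close> about \<open>E\<close> cover these points; the rest of \<open>D\<^bsub>n-1\<^esub>\<close> is compact and wandering, and
  finitely many small sets without returns cover it (\<open>finite_labelling_of_blocks\<close>). Cut an orbit of
  length \<open>N\<close> into \<open>k = N div n\<close> blocks, followed by fewer than \<open>n\<close> remaining points, and record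
  which set of the cover each block starts in, and near which point of a fixed finite \<open>2\<epsilon>\<close>-net each
  remaining point lies. Orbits with the same record are \<open>4\<epsilon>\<close>-close. The
  \<open>m\<close> labels of wandering sets occur at most once each, so there are at most \<open>(k + 1)\<^sup>m s\<^sup>k Q\<close> records,
  where \<open>Q\<close> does not depend on \<open>N\<close> (\<open>card_words_with_rare_letters\<close>, \<open>card_separated_le\<close>). Dividing
  the logarithm by \<open>N\<close> and letting \<open>N\<close> tend to infinity bounds the growth rate of the whole system
  at scale \<open>4\<epsilon>\<close> by \<open>(log s) / n\<close>, for every \<open>n\<close> (\<open>entropy_eps_le_one_block\<close>). Taking the upper limit
  in \<open>n\<close>, and then the supremum over the scales, gives \<open>h(\<sigma>) \<le> h(\<sigma>|\<Omega>)\<close>. The converse inequality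
  holds because \<open>\<Omega>\<close> is closed and forward invariant: separated sets of the restricted system are
  separated sets of the whole one.
\<close>

section \<open>Iterates of a partially defined map\<close>

lemma funpow_add_apply: "(f ^^ (m + n)) x = (f ^^ n) ((f ^^ m) x)"
  by (simp add: funpow_add add.commute[of m])

lemma dom_iter_subset:
  assumes "D \<subseteq> X"
  shows "dom_iter X D f n \<subseteq> X"
  using assms by (cases n) auto

lemma dom_iter_add_iff:
  assumes "D \<subseteq> X"
  shows "x \<in> dom_iter X D f (m + n) \<longleftrightarrow> x \<in> dom_iter X D f m \<and> (f ^^ m) x \<in> dom_iter X D f n"
proof (induction m arbitrary: x)
  case 0
  then show ?case using dom_iter_subset[OF assms] by auto
next
  case (Suc m)
  then show ?case by (auto simp: funpow_swap1)
qed

lemma dom_iter_antimono: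
  assumes "D \<subseteq> X" "m \<le> n"
  shows "dom_iter X D f n \<subseteq> dom_iter X D f m"
  using dom_iter_add_iff[OF assms(1), of _ f m "n - m"] assms(2) by auto

text \<open>
  For points whose orbits survive up to time \<open>n - 1\<close> the maximum that defines \<open>dist_iter\<close> ranges over
  all times below \<open>n\<close>. Only such points occur in the separated sets that \<open>ssep\<close> counts, so
  the distances there are those of the usual Bowen metric.
\<close>

lemma less_dist_iter_iff:
  assumes "D \<subseteq> X" "1 \<le> n" "x \<in> dom_iter X D f (n - 1)" "y \<in> dom_iter X D f (n - 1)"
  shows "\<epsilon> < dist_iter X D f n x y \<longleftrightarrow> (\<exists>i<n. \<epsilon> < dist ((f ^^ i) x) ((f ^^ i) y))"
proof -
  have "z \<in> dom_iter X D f i" if "i < n" "z \<in> dom_iter X D f (n - 1)" for i z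
  proof -
    have "i \<le> n - 1" using that(1) by simp
    then show ?thesis using dom_iter_antimono[OF assms(1)] that(2) by blast
  qed
  then have *: "{dist ((f ^^ i) x) ((f ^^ i) y) | i. i < n \<and> x \<in> dom_iter X D f i \<and> y \<in> dom_iter X D f i}
      = (\<lambda>i. dist ((f ^^ i) x) ((f ^^ i) y)) ` {..<n}"
    using assms by auto
  have "{..<n} \<noteq> {}" using assms(2) by (auto simp: lessThan_empty_iff)
  then show ?thesis
    unfolding dist_iter_def * by (subst Max_gr_iff) auto
qed

section \<open>Monotonicity of entropy in the scale\<close>

lemma log_enat_mono: "a \<le> b \<Longrightarrow> log_enat a \<le> log_enat b"
  by (auto simp: log_enat_def split: enat.splits)

lemma ssep_antimono:
  assumes "\<delta> \<le> \<epsilon>"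
  shows "ssep X D f n \<epsilon> K \<le> ssep X D f n \<delta> K"
proof -
  have "sep X D f n \<epsilon> S \<le> sep X D f n \<delta> S" for S
    unfolding sep_def
    by (rule SUP_subset_mono) (use assms in \<open>force simp: separated_def\<close>)+
  then show ?thesis
    unfolding ssep_def by (intro SUP_mono) blast
qed

lemma entropy_eps_mono:
  assumes "\<And>n. 1 \<le> n \<Longrightarrow> ssep X D f n \<epsilon> K \<le> ssep X' D' f' n \<delta> K'"
  shows "entropy_eps X D f \<epsilon> K \<le> entropy_eps X' D' f' \<delta> K'"
  unfolding entropy_eps_def
proof (intro Limsup_mono eventually_mono[OF eventually_ge_at_top[of 1]])
  fix n :: nat assume "1 \<le> n"
  then show "ereal (1 / real n) * log_enat (ssep X D f n \<epsilon> K)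
      \<le> ereal (1 / real n) * log_enat (ssep X' D' f' n \<delta> K')"
    by (intro ereal_mult_left_mono log_enat_mono assms) auto
qed

text \<open>
  The growth rate increases as the scale decreases, so its limit at \<open>0\<close> exists and is a supremum.
  In this form a bound between two systems may change the scale by a constant factor.
\<close>

lemma entropy_on_eq_SUP:
  "entropy_on X D f K = (SUP \<epsilon>\<in>{0<..}. entropy_eps X D f \<epsilon> K)"
proof -
  let ?g = "\<lambda>\<epsilon>. entropy_eps X D f \<epsilon> K"
  have "(?g \<longlongrightarrow> (SUP \<epsilon>\<in>{0<..}. ?g \<epsilon>)) (at_right 0)"
  proof (rule order_tendstoI)
    fix a assume "a < (SUP \<epsilon>\<in>{0<..}. ?g \<epsilon>)"
    then obtain \<epsilon> where \<epsilon>: "\<epsilon> > 0" "a < ?g \<epsilon>" by (auto simp: less_SUP_iff)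
    have "a < ?g \<delta>" if "\<delta> < \<epsilon>" for \<delta>
      using \<epsilon>(2) that by (intro less_le_trans[OF \<epsilon>(2)] entropy_eps_mono ssep_antimono) auto
    then show "\<forall>\<^sub>F \<delta> in at_right 0. a < ?g \<delta>"
      using \<epsilon>(1) by (auto simp: eventually_at_right_field)
  next
    fix a assume a: "(SUP \<epsilon>\<in>{0<..}. ?g \<epsilon>) < a"
    have "?g \<delta> < a" if "\<delta> > 0" for \<delta>
      using that by (intro le_less_trans[OF SUP_upper a]) auto
    then show "\<forall>\<^sub>F \<delta> in at_right 0. ?g \<delta> < a"
      by (auto simp: eventually_at_right_field intro: exI[of _ 1])
  qed
  then show ?thesis
    unfolding entropy_on_def by (intro tendsto_Lim) auto
qed

section \<open>Words in which some letters occur at most once\<close>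

text \<open>
  A word over \<open>E \<union> M\<close> of length \<open>k\<close> in which each letter of \<open>M\<close> occurs at most once is determined by
  the position of each of these letters (with \<open>k\<close> standing for absence) and by its letters from \<open>E\<close>,
  padded arbitrarily elsewhere. There is nothing to pad with if \<open>E\<close> is empty; then a word is an
  injection into \<open>M\<close>, which \<open>card M < k\<close> excludes, in accordance with the value \<open>0\<close> of the bound.
\<close>

lemma card_words_with_rare_letters:
  fixes E M :: "'a set"
  assumes "finite E" "finite M" "E \<inter> M = {}" "card M < k"
  defines "I \<equiv> {g \<in> {..<k} \<rightarrow>\<^sub>E E \<union> M. inj_on g {i. i < k \<and> g i \<in> M}}"
  shows "card I \<le> (k + 1) ^ card M * card E ^ k"
proof (cases "E = {}")
  case True
  have "False" if "g \<in> I" for g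
  proof -
    have "g ` {..<k} \<subseteq> M" using that True by (auto simp: I_def)
    moreover from this have "{i. i < k \<and> g i \<in> M} = {..<k}" by auto
    ultimately have "inj_on g {..<k}" using that by (auto simp: I_def)
    then have "card {..<k} \<le> card M"
      using \<open>g ` {..<k} \<subseteq> M\<close> assms(2) by (rule card_inj_on_le)
    then show False using assms(4) by simp
  qed
  then have "I = {}" by blast
  then show ?thesis by simp
next
  case False
  then obtain e where e: "e \<in> E" by blast
  define pos where "pos g = (\<lambda>w\<in>M. if w \<in> g ` {..<k} then inv_into {..<k} g w else k)" for g
  define val where "val g = (\<lambda>i\<in>{..<k}. if g i \<in> E then g i else e)" for g
  have pos_iff: "pos g w = i \<longleftrightarrow> g i = w" if "g \<in> I" "w \<in> M" "i < k" for g w i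
  proof
    assume "pos g w = i"
    then have "w \<in> g ` {..<k}" "inv_into {..<k} g w = i"
      using that by (auto simp: pos_def split: if_splits)
    then show "g i = w" by (metis f_inv_into_f)
  next
    assume gi: "g i = w"
    let ?j = "inv_into {..<k} g w"
    have w: "w \<in> g ` {..<k}" using gi that(3) by auto
    have "g ?j = w" "?j < k"
      using f_inv_into_f[OF w] inv_into_into[OF w] by auto
    moreover have "inj_on g {i. i < k \<and> g i \<in> M}" using that(1) by (simp add: I_def)
    ultimately have "?j = i" using gi that by (auto dest: inj_onD)
    then show "pos g w = i" using w that(2) by (simp add: pos_def)
  qed
  have pos_in: "pos g \<in> M \<rightarrow>\<^sub>E {..k}" for g
    using inv_into_into[of _ g "{..<k}"] by (auto simp: pos_def less_imp_le)
  have val_in: "val g \<in> {..<k} \<rightarrow>\<^sub>E E" for g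
    using e by (auto simp: val_def)
  have "inj_on (\<lambda>g. (pos g, val g)) I"
  proof (rule inj_onI)
    fix g h assume gh: "g \<in> I" "h \<in> I" and "(pos g, val g) = (pos h, val h)"
    then have p: "pos g = pos h" and v: "val g = val h" by auto
    have G: "g \<in> {..<k} \<rightarrow>\<^sub>E E \<union> M" and H: "h \<in> {..<k} \<rightarrow>\<^sub>E E \<union> M"
      using gh by (auto simp: I_def)
    have "g i = h i" if i: "i < k" for i
    proof (cases "g i \<in> M \<or> h i \<in> M")
      case True
      then show ?thesis using pos_iff[OF gh(1) _ i] pos_iff[OF gh(2) _ i] p by metis
    next
      case False
      then have "g i \<in> E" "h i \<in> E" using G H i by (auto simp: PiE_iff)
      then show ?thesis using fun_cong[OF v, of i] i by (simp add: val_def)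
    qed
    then show "g = h" using G H by (intro PiE_ext) auto
  qed
  moreover have "(\<lambda>g. (pos g, val g)) ` I \<subseteq> (M \<rightarrow>\<^sub>E {..k}) \<times> ({..<k} \<rightarrow>\<^sub>E E)"
    using pos_in val_in by auto
  ultimately have "card I \<le> card ((M \<rightarrow>\<^sub>E {..k}) \<times> ({..<k} \<rightarrow>\<^sub>E E))"
    using assms(1,2) by (intro card_inj_on_le) (auto intro: finite_PiE)
  also have "\<dots> = (k + 1) ^ card M * card E ^ k"
    using assms(2) by (simp add: card_cartesian_product card_funcsetE)
  finally show ?thesis .
qed

section \<open>Growth of the itinerary bound\<close>

text \<open>
  The factors \<open>(N div n + 1) ^ m\<close> and \<open>Q\<close> grow at most polynomially in \<open>N\<close> and have growth rate \<open>0\<close>,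
  while \<open>s ^ (N div n)\<close> has growth rate at most \<open>ln s / n\<close>. The case \<open>s = 0\<close> matters: there
  both sides are \<open>-\<infinity>\<close>, as happens when every orbit leaves the domain.
\<close>

lemma limsup_log_itinerary_bound:
  fixes a :: "nat \<Rightarrow> enat"
  assumes n: "1 \<le> n" and Q: "1 \<le> Q"
    and bound: "\<And>N. N0 \<le> N \<Longrightarrow> a N \<le> enat ((N div n + 1) ^ m * s ^ (N div n) * Q)"
  shows "limsup (\<lambda>N. ereal (1 / real N) * log_enat (a N)) \<le> ereal (1 / real n) * log_enat (enat s)"
proof (cases "s = 0")
  case True
  have "a N = 0" if "max N0 n \<le> N" for N
  proof -
    have "N div n > 0" using that n by (simp add: div_greater_zero_iff)
    then have "(N div n + 1) ^ m * s ^ (N div n) * Q = 0" unfolding True by (subst power_0_left) simp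
    then have "a N \<le> enat 0" using bound[of N] that by (metis max.boundedE)
    then show ?thesis by (simp flip: zero_enat_def)
  qed
  then have "ereal (1 / real N) * log_enat (a N) \<le> -\<infinity>" if "max N0 n \<le> N" for N
    using that n by (simp add: log_enat_def zero_enat_def)
  then have "limsup (\<lambda>N. ereal (1 / real N) * log_enat (a N)) \<le> -\<infinity>"
    by (intro Limsup_bounded eventually_mono[OF eventually_ge_at_top[of "max N0 n"]])
  then show ?thesis by simp
next
  case False
  then have s: "1 \<le> s" by simp
  define b where "b N = (real m * ln (real N + 1) + ln (real Q)) / real N + ln (real s) / real n" for N
  have le: "ereal (1 / real N) * log_enat (a N) \<le> ereal (b N)" if N: "max N0 1 \<le> N" for N
  proof -
    let ?k = "N div n"
    have "log_enat (a N) \<le> log_enat (enat ((?k + 1) ^ m * s ^ ?k * Q))"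
      using bound N by (intro log_enat_mono) auto
    also have "\<dots> = ereal (ln (real ((?k + 1) ^ m * s ^ ?k * Q)))"
      using s Q by (simp add: log_enat_def)
    also have "ln (real ((?k + 1) ^ m * s ^ ?k * Q))
        = real m * ln (real ?k + 1) + real ?k * ln (real s) + ln (real Q)"
      using s Q by (simp add: ln_mult ln_realpow add_ac)
    finally have "ereal (1 / real N) * log_enat (a N)
        \<le> ereal (1 / real N) * ereal (real m * ln (real ?k + 1) + real ?k * ln (real s) + ln (real Q))"
      by (intro ereal_mult_left_mono) auto
    also have "\<dots> = ereal ((real m * ln (real ?k + 1) + ln (real Q)) / real N + real ?k / real N * ln (real s))"
      by (simp add: field_simps add_divide_distrib)
    also have "\<dots> \<le> ereal (b N)"
    proof -
      have "real (?k * n) \<le> real N" by (subst of_nat_le_iff) simp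
      then have 1: "real ?k / real N \<le> 1 / real n" using N n by (simp add: field_simps)
      have "real ?k \<le> real N" by simp
      then have 2: "ln (real ?k + 1) \<le> ln (real N + 1)" by simp
      have "real ?k / real N * ln (real s) \<le> 1 / real n * ln (real s)"
        using 1 s by (intro mult_right_mono) auto
      moreover have "(real m * ln (real ?k + 1) + ln (real Q)) / real N
          \<le> (real m * ln (real N + 1) + ln (real Q)) / real N"
        using 2 by (intro divide_right_mono add_right_mono mult_left_mono) auto
      ultimately show ?thesis by (simp add: b_def)
    qed
    finally show ?thesis .
  qed
  have "(\<lambda>N. ln (real N + 1) / real N) \<longlonglongrightarrow> 0" 
    by real_asymp
  moreover have "(\<lambda>N. ln (real Q) / real N) \<longlonglongrightarrow> 0" by real_asymp
  ultimately have "(\<lambda>N. real m * (ln (real N + 1) / real N) + ln (real Q) / real N + ln (real s) / real n)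
      \<longlonglongrightarrow> real m * 0 + 0 + ln (real s) / real n"
    by (intro tendsto_intros)
  then have "b \<longlonglongrightarrow> ln (real s) / real n"
    by (simp add: b_def[abs_def] add_divide_distrib)
  then have lim: "limsup (\<lambda>N. ereal (b N)) = ereal (ln (real s) / real n)"
    by (intro lim_imp_Limsup) auto
  have "limsup (\<lambda>N. ereal (1 / real N) * log_enat (a N)) \<le> limsup (\<lambda>N. ereal (b N))"
    by (intro Limsup_mono eventually_mono[OF eventually_ge_at_top[of "max N0 1"]] le)
  also note lim
  finally show ?thesis using s by (simp add: log_enat_def)
qed

section \<open>The nonwandering set\<close>

text \<open>
  For negative \<open>k\<close> the set \<open>iter_image (- k) (iter_image k U)\<close> lies inside \<open>U\<close>, so these conditions
  follow from the one for \<open>k = 0\<close>. What remains says that no two orbits starting in \<open>U\<close> merge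
  with a time lag.
\<close>

lemma wandering_iff:
  assumes "D \<subseteq> X"
  shows "wandering X D f x \<longleftrightarrow>
    (\<exists>U. openin (top_of_set X) U \<and> x \<in> U \<and>
      (\<forall>n k. 1 \<le> n \<longrightarrow> (\<forall>u\<in>U \<inter> dom_iter X D f (n + k). \<forall>v\<in>U \<inter> dom_iter X D f k.
         (f ^^ (n + k)) u \<noteq> (f ^^ k) v)))"
proof -
  have iff: "(\<forall>n::nat. \<forall>k::int. 1 \<le> n \<longrightarrow>
          iter_image X D f (int n) U \<inter> iter_image X D f (- k) (iter_image X D f k U) = {})
      \<longleftrightarrow> (\<forall>n k. 1 \<le> n \<longrightarrow> (\<forall>u\<in>U \<inter> dom_iter X D f (n + k). \<forall>v\<in>U \<inter> dom_iter X D f k.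
         (f ^^ (n + k)) u \<noteq> (f ^^ k) v))" (is "?L \<longleftrightarrow> ?R")
    if U: "U \<subseteq> X" for U
  proof
    assume L: ?L
    show ?R
    proof (intro allI impI ballI notI)
      fix n k u v
      assume n: "1 \<le> (n::nat)" and u: "u \<in> U \<inter> dom_iter X D f (n + k)"
        and v: "v \<in> U \<inter> dom_iter X D f k" and eq: "(f ^^ (n + k)) u = (f ^^ k) v"
      have u': "u \<in> dom_iter X D f n" "(f ^^ n) u \<in> dom_iter X D f k"
        using u dom_iter_add_iff[OF assms, of u f n k] by auto
      have "(f ^^ k) ((f ^^ n) u) = (f ^^ k) v"
        using eq by (simp add: funpow_add_apply)
      then have "(f ^^ n) u \<in> iter_image X D f (- int k) (iter_image X D f (int k) U)"
        using u u' v U by (cases "k = 0") (auto simp: iter_image_def)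
      moreover have "(f ^^ n) u \<in> iter_image X D f (int n) U"
        using u u' by (auto simp: iter_image_def)
      ultimately show False using L n by blast
    qed
  next
    assume R: ?R
    show ?L
    proof (intro allI impI equals0I)
      fix n :: nat and k :: int and y
      assume n: "1 \<le> n"
        and y: "y \<in> iter_image X D f (int n) U \<inter> iter_image X D f (- k) (iter_image X D f k U)"
      then obtain u where u: "u \<in> U" "u \<in> dom_iter X D f n" "y = (f ^^ n) u"
        by (auto simp: iter_image_def)
      show False
      proof (cases "k > 0")
        case True
        define j where "j = nat k"
        obtain v where v: "v \<in> U" "v \<in> dom_iter X D f j" "(f ^^ j) y = (f ^^ j) v"
          and yj: "y \<in> dom_iter X D f j"
          using y True by (auto simp: iter_image_def j_def)
        have "u \<in> dom_iter X D f (n + j)" using u yj dom_iter_add_iff[OF assms] by blast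
        moreover have "(f ^^ (n + j)) u = (f ^^ j) v"
          using v(3) u(3) by (simp add: funpow_add_apply)
        ultimately show False using R n u(1) v(1,2) by blast
      next
        case False
        then have "y \<in> U" using y by (auto simp: iter_image_def split: if_splits)
        then show False using R[rule_format, of n u 0 y] n u U by auto
      qed
    qed
  qed
  show ?thesis
    unfolding wandering_def
    by (rule ex_cong1, rule conj_cong[OF refl], rule conj_cong[OF refl], rule iff)
       (erule openin_imp_subset)
qed

text \<open>A neighbourhood that witnesses wandering does so for each of its points.\<close>

lemma closedin_nonwandering_set: "closedin (top_of_set X) (nonwandering_set X D f)"
proof -
  have "openin (top_of_set X) (X - nonwandering_set X D f)"
  proof (subst openin_subopen, intro ballI)
    fix x assume "x \<in> X - nonwandering_set X D f"
    then obtain U where U: "openin (top_of_set X) U" "x \<in> U"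
        "\<And>n k. 1 \<le> n \<Longrightarrow> iter_image X D f (int n) U \<inter> iter_image X D f (- k) (iter_image X D f k U) = {}"
      unfolding nonwandering_set_def wandering_def by blast
    have "wandering X D f y" if "y \<in> U" for y
      unfolding wandering_def using U that by blast
    then have "U \<subseteq> X - nonwandering_set X D f"
      using openin_imp_subset[OF U(1)] by (auto simp: nonwandering_set_def)
    then show "\<exists>T. openin (top_of_set X) T \<and> x \<in> T \<and> T \<subseteq> X - nonwandering_set X D f"
      using U by blast
  qed
  then show ?thesis by (simp add: closedin_def nonwandering_set_def Collect_restrict)
qed

section \<open>Partial maps with clopen domain\<close>

lemma local_homeomorphism_onto_imp_continuous_on:
  assumes "local_homeomorphism_onto S T f"
  shows "continuous_on S f"
  unfolding continuous_openin_preimage_eq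
proof (intro allI impI)
  fix V :: "'b set" assume V: "open V"
  show "openin (top_of_set S) (S \<inter> f -` V)"
  proof (subst openin_subopen, intro ballI)
    fix x assume x: "x \<in> S \<inter> f -` V"
    then obtain U g where U: "x \<in> U" "openin (top_of_set S) U" "homeomorphism U (f ` U) f g"
      using assms unfolding local_homeomorphism_onto_def by blast
    have "openin (top_of_set U) (U \<inter> f -` V)"
      using U(3) V by (intro continuous_openin_preimage_gen) (auto simp: homeomorphism_def)
    then have "openin (top_of_set S) (U \<inter> f -` V)" using U(2) openin_trans by blast
    then show "\<exists>W. openin (top_of_set S) W \<and> x \<in> W \<and> W \<subseteq> S \<inter> f -` V"
      using x U openin_imp_subset[OF U(2)] by blast
  qed
qed

text \<open>
  Continuity makes the domains of all iterates clopen, hence compact; the covering arguments rest on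
  this.
\<close>

locale clopen_partial_map =
  fixes X D :: "'a::metric_space set" and f :: "'a \<Rightarrow> 'a"
  assumes compact_X: "compact X"
    and openin_D: "openin (top_of_set X) D"
    and closedin_D: "closedin (top_of_set X) D"
    and continuous_f: "continuous_on D f"
    and f_into: "f ` D \<subseteq> X"
begin

abbreviation "Dom n \<equiv> dom_iter X D f n"
abbreviation "\<Omega> \<equiv> nonwandering_set X D f"

lemma D_subset: "D \<subseteq> X"
  using openin_D by (rule openin_imp_subset)

lemma Dom_subset: "Dom n \<subseteq> X"
  using D_subset by (rule dom_iter_subset)

lemma Dom_antimono: "m \<le> n \<Longrightarrow> Dom n \<subseteq> Dom m"
  using D_subset by (rule dom_iter_antimono)

lemma Dom_add_iff: "x \<in> Dom (m + n) \<longleftrightarrow> x \<in> Dom m \<and> (f ^^ m) x \<in> Dom n"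
  using D_subset by (rule dom_iter_add_iff)

lemma Dom_Suc_eq: "Dom (Suc n) = D \<inter> f -` Dom n"
  by auto

lemma openin_Dom: "openin (top_of_set X) (Dom n)"
proof (induction n)
  case (Suc n)
  then have "openin (top_of_set D) (D \<inter> f -` Dom n)"
    using continuous_f f_into by (intro continuous_openin_preimage) auto
  then show ?case unfolding Dom_Suc_eq using openin_D by (rule openin_trans)
qed simp

lemma closedin_Dom: "closedin (top_of_set X) (Dom n)"
proof (induction n)
  case (Suc n)
  then have "closedin (top_of_set D) (D \<inter> f -` Dom n)"
    using continuous_f f_into by (intro continuous_closedin_preimage_gen) auto
  then show ?case unfolding Dom_Suc_eq using closedin_D by (rule closedin_trans)
qed simp

lemma continuous_on_funpow: "continuous_on (Dom n) (f ^^ n)"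
proof (induction n)
  case 0
  then show ?case by (simp add: continuous_on_id)
next
  case (Suc n)
  have "continuous_on (Dom (Suc n)) ((f ^^ n) \<circ> f)"
  proof (intro continuous_on_compose)
    show "continuous_on (Dom (Suc n)) f"
      by (rule continuous_on_subset[OF continuous_f]) auto
    show "continuous_on (f ` Dom (Suc n)) (f ^^ n)"
      by (rule continuous_on_subset[OF Suc]) auto
  qed
  then show ?case by (simp add: funpow_Suc_right del: funpow.simps dom_iter.simps)
qed

text \<open>
  If a neighbourhood \<open>V\<close> of \<open>f x\<close> has no two orbits that merge with a time lag, then neither has its
  preimage: if the orbits of \<open>u\<close> and \<open>v\<close> merge, then so do those of \<open>f u\<close> and \<open>f v\<close>, with the same lag.
\<close>

lemma nonwandering_invariant:
  assumes "x \<in> \<Omega>" "x \<in> D"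
  shows "f x \<in> \<Omega>"
proof (rule ccontr)
  assume "f x \<notin> \<Omega>"
  then have "wandering X D f (f x)"
    using assms(2) f_into by (auto simp: nonwandering_set_def)
  then obtain V where V: "openin (top_of_set X) V" "f x \<in> V" 
    and disj: "\<And>n k u v. \<lbrakk>1 \<le> n; u \<in> V \<inter> Dom (n + k); v \<in> V \<inter> Dom k\<rbrakk> \<Longrightarrow> (f ^^ (n + k)) u \<noteq> (f ^^ k) v"
    unfolding wandering_iff[OF D_subset] by blast
  define U where "U = D \<inter> f -` V"
  have "openin (top_of_set D) U"
    unfolding U_def using continuous_f f_into V(1) by (intro continuous_openin_preimage) auto
  then have "openin (top_of_set X) U" using openin_D by (rule openin_trans)
  moreover have "x \<in> U" using V(2) assms(2) by (simp add: U_def)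
  moreover have "(f ^^ (n + k)) u \<noteq> (f ^^ k) v"
    if n: "1 \<le> n" and u: "u \<in> U \<inter> Dom (n + k)" and v: "v \<in> U \<inter> Dom k" for n k u v
  proof
    assume eq: "(f ^^ (n + k)) u = (f ^^ k) v"
    show False
      \<comment> \<open>for \<open>k = 0\<close> the orbit of \<open>u\<close> merely reaches \<open>v\<close>; it continues to \<open>f v\<close> because \<open>v\<close> lies in \<open>D\<close>\<close>
    proof (cases k)
      case 0
      then have "v = (f ^^ n) u" using eq by simp
      moreover have "v \<in> D" using v by (simp add: U_def)
      ultimately have "u \<in> Dom (n + 1)"
        using u 0 f_into unfolding Dom_add_iff by auto
      then have "f u \<in> Dom n" by simp
      moreover have "(f ^^ n) (f u) = f v"
        using \<open>v = (f ^^ n) u\<close> by (simp add: funpow_swap1)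
      moreover have "f u \<in> V" "f v \<in> V" using u v by (auto simp: U_def)
      ultimately show False
        using disj[of n "f u" 0 "f v"] n openin_imp_subset[OF V(1)] by auto
    next
      case (Suc j)
      have "f u \<in> V \<inter> Dom (n + j)" "f v \<in> V \<inter> Dom j" using u v Suc by (auto simp: U_def)
      moreover have "(f ^^ (n + j)) (f u) = (f ^^ j) (f v)"
        using eq Suc by (simp add: funpow_swap1)
      ultimately show False using disj n by blast
    qed
  qed
  ultimately have "wandering X D f x" unfolding wandering_iff[OF D_subset] by blast
  then show False using assms(1) by (simp add: nonwandering_set_def)
qed

text \<open>By invariance an orbit starting in \<open>\<Omega>\<close> can be cut short only by leaving \<open>D\<close>.\<close>

lemma Dom_restrict: "dom_iter \<Omega> (D \<inter> \<Omega>) f n = \<Omega> \<inter> Dom n"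
proof (induction n)
  case 0
  then show ?case by (auto simp: nonwandering_set_def)
next
  case (Suc n)
  then show ?case using nonwandering_invariant by auto
qed

text \<open>
  For \<open>k = 0\<close> the characterisation says that no orbit starting in \<open>U\<close> returns to \<open>U\<close>; in this form
  wandering enters the counting.
\<close>

lemma wandering_nbhd:
  assumes "x \<in> X" "x \<notin> \<Omega>"
  obtains U where "openin (top_of_set X) U" "x \<in> U"
    "\<And>n u. \<lbrakk>1 \<le> n; u \<in> U; u \<in> Dom n\<rbrakk> \<Longrightarrow> (f ^^ n) u \<notin> U"
proof -
  obtain U where U: "openin (top_of_set X) U" "x \<in> U"
    and disj: "\<And>n k u v. \<lbrakk>1 \<le> n; u \<in> U \<inter> Dom (n + k); v \<in> U \<inter> Dom k\<rbrakk> \<Longrightarrow> (f ^^ (n + k)) u \<noteq> (f ^^ k) v"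
    using assms unfolding nonwandering_set_def mem_Collect_eq wandering_iff[OF D_subset] by blast
  have "(f ^^ n) u \<notin> U" if "1 \<le> n" "u \<in> U" "u \<in> Dom n" for n u
    using disj[of n u 0 "(f ^^ n) u"] that openin_imp_subset[OF U(1)] by auto
  with U that show thesis by blast
qed

text \<open>
  The open ball of the metric \<open>d\<^sub>n\<close> within the points that survive up to time \<open>n - 1\<close>; the centre is
  meant to be such a point as well.
\<close>

definition bowen_ball :: "nat \<Rightarrow> real \<Rightarrow> 'a \<Rightarrow> 'a set" where
  "bowen_ball n r e = {x \<in> Dom (n - 1). \<forall>i<n. dist ((f ^^ i) x) ((f ^^ i) e) < r}"

lemma openin_bowen_ball: "openin (top_of_set X) (bowen_ball n r e)"
proof -
  have "openin (top_of_set X) {x \<in> Dom (n - 1). dist ((f ^^ i) x) ((f ^^ i) e) < r}" if "i < n" for i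
  proof -
    have "Dom (n - 1) \<subseteq> Dom i" using that by (intro Dom_antimono) simp
    then have "continuous_on (Dom (n - 1)) (f ^^ i)"
      using continuous_on_funpow continuous_on_subset by blast
    then have "openin (top_of_set (Dom (n - 1))) (Dom (n - 1) \<inter> (f ^^ i) -` ball ((f ^^ i) e) r)"
      by (intro continuous_openin_preimage_gen) auto
    also have "Dom (n - 1) \<inter> (f ^^ i) -` ball ((f ^^ i) e) r
        = {x \<in> Dom (n - 1). dist ((f ^^ i) x) ((f ^^ i) e) < r}"
      by (auto simp: dist_commute)
    finally show ?thesis using openin_Dom openin_trans by blast
  qed
  then have "openin (top_of_set X) (Dom (n - 1) \<inter> (\<Inter>i\<in>{..<n}. {x \<in> Dom (n - 1). dist ((f ^^ i) x) ((f ^^ i) e) < r}))"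
    by (cases "n = 0") (auto intro!: openin_Int openin_INT2 openin_Dom simp del: dom_iter.simps)
  moreover have "Dom (n - 1) \<inter> (\<Inter>i\<in>{..<n}. {x \<in> Dom (n - 1). dist ((f ^^ i) x) ((f ^^ i) e) < r}) = bowen_ball n r e"
    by (auto simp: bowen_ball_def)
  ultimately show ?thesis by simp
qed

text \<open>
  The labels are the centres of a finite cover of \<open>D\<^bsub>n-1\<^esub>\<close>: Bowen balls about the points of \<open>E\<close>,
  and, for what these leave uncovered, smaller sets about points of \<open>M\<close>. The uncovered part is
  compact and disjoint from \<open>\<Omega>\<close>, so the sets of the second kind can be taken without returns; hence
  a label from \<open>M\<close> does not occur twice along an orbit. A point of \<open>E\<close> lies in its own Bowen ball,
  which keeps the two kinds of labels apart.
\<close>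

lemma finite_labelling_of_blocks:
  assumes n: "1 \<le> n" and \<epsilon>: "0 < \<epsilon>" and E: "E \<subseteq> Dom (n - 1)"
    and span: "\<forall>x\<in>\<Omega> \<inter> Dom (n - 1). \<exists>e\<in>E. \<forall>i<n. dist ((f ^^ i) x) ((f ^^ i) e) \<le> \<epsilon>"
  obtains M c where "finite M" "E \<inter> M = {}"
    "\<And>x. x \<in> Dom (n - 1) \<Longrightarrow> c x \<in> E \<union> M"
    "\<And>x y i. \<lbrakk>x \<in> Dom (n - 1); y \<in> Dom (n - 1); c x = c y; i < n\<rbrakk> \<Longrightarrow> dist ((f ^^ i) x) ((f ^^ i) y) < 4 * \<epsilon>"
    "\<And>x j. \<lbrakk>x \<in> Dom (n - 1); 1 \<le> j; x \<in> Dom j; (f ^^ j) x \<in> Dom (n - 1); c x \<in> M\<rbrakk> \<Longrightarrow> c ((f ^^ j) x) \<noteq> c x"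
proof -
  let ?B = "bowen_ball n (2 * \<epsilon>)"
  have center: "w \<in> ?B w" if "w \<in> Dom (n - 1)" for w
    using that \<epsilon> by (simp add: bowen_ball_def)
  define K where "K = Dom (n - 1) - (\<Union>e\<in>E. ?B e)"
  have "closedin (top_of_set X) K"
    unfolding K_def by (intro closedin_diff closedin_Dom openin_Union) (auto intro: openin_bowen_ball)
  then have "compact K" using compact_X closedin_compact by blast
  have "\<exists>U. openin (top_of_set X) U \<and> w \<in> U \<and> (\<forall>n u. 1 \<le> n \<longrightarrow> u \<in> U \<longrightarrow> u \<in> Dom n \<longrightarrow> (f ^^ n) u \<notin> U)"
    if "w \<in> K" for w
  proof -
    have "w \<in> Dom (n - 1)" using that by (simp add: K_def)
    moreover have "w \<notin> \<Omega>"
    proof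
      assume "w \<in> \<Omega>"
      then obtain e where "e \<in> E" "\<forall>i<n. dist ((f ^^ i) w) ((f ^^ i) e) \<le> \<epsilon>"
        using span \<open>w \<in> Dom (n - 1)\<close> by blast
      then have "w \<in> ?B e" using \<epsilon> \<open>w \<in> Dom (n - 1)\<close> by (force simp: bowen_ball_def)
      then show False using that \<open>e \<in> E\<close> by (auto simp: K_def)
    qed
    ultimately show ?thesis using wandering_nbhd[of w] Dom_subset by (metis subsetD)
  qed
  then obtain U where U: "\<And>w. w \<in> K \<Longrightarrow> openin (top_of_set X) (U w)" "\<And>w. w \<in> K \<Longrightarrow> w \<in> U w"
    and no_return: "\<And>w j u. \<lbrakk>w \<in> K; 1 \<le> j; u \<in> U w; u \<in> Dom j\<rbrakk> \<Longrightarrow> (f ^^ j) u \<notin> U w"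
    by metis
  have "\<exists>T. open T \<and> U w \<inter> ?B w = X \<inter> T" if "w \<in> K" for w
    using openin_Int[OF U(1)[OF that] openin_bowen_ball] by (auto simp: openin_open)
  then obtain T where T: "\<And>w. w \<in> K \<Longrightarrow> open (T w)" "\<And>w. w \<in> K \<Longrightarrow> U w \<inter> ?B w = X \<inter> T w"
    by metis
  have "K \<subseteq> (\<Union>w\<in>K. T w)"
  proof
    fix w assume w: "w \<in> K"
    then have "w \<in> U w \<inter> ?B w" using U(2) center by (auto simp: K_def)
    then show "w \<in> (\<Union>w\<in>K. T w)" using T(2)[OF w] w by auto
  qed
  then obtain M where M: "M \<subseteq> K" "finite M" "K \<subseteq> (\<Union>w\<in>M. T w)"
    using compactE_image[OF \<open>compact K\<close>, of K T] T(1) by metis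
  define G where "G w = (if w \<in> E then ?B w else U w \<inter> ?B w)" for w
  have disj: "E \<inter> M = {}"
    using M(1) E center by (auto simp: K_def)
  have "\<exists>w. w \<in> E \<union> M \<and> x \<in> G w" if x: "x \<in> Dom (n - 1)" for x
  proof (cases "x \<in> K")
    case True
    then obtain w where "w \<in> M" "x \<in> T w" using M(3) by blast
    then have "x \<in> U w \<inter> ?B w" using T(2)[of w] M(1) x Dom_subset by blast
    then show ?thesis using \<open>w \<in> M\<close> disj by (auto simp: G_def)
  next
    case False
    then show ?thesis using x by (auto simp: K_def G_def)
  qed
  then obtain c where c: "\<And>x. x \<in> Dom (n - 1) \<Longrightarrow> c x \<in> E \<union> M" "\<And>x. x \<in> Dom (n - 1) \<Longrightarrow> x \<in> G (c x)"
    by metis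
  show thesis
  proof (rule that[OF M(2) disj c(1)])
    fix x y i assume xy: "x \<in> Dom (n - 1)" "y \<in> Dom (n - 1)" "c x = c y" "i < n"
    have "x \<in> ?B (c x)" "y \<in> ?B (c x)"
      using c(2)[OF xy(1)] c(2)[OF xy(2)] xy(3) by (auto simp: G_def split: if_splits)
    then have "dist ((f ^^ i) x) ((f ^^ i) (c x)) < 2 * \<epsilon>" "dist ((f ^^ i) y) ((f ^^ i) (c x)) < 2 * \<epsilon>"
      using xy(4) by (auto simp: bowen_ball_def)
    then show "dist ((f ^^ i) x) ((f ^^ i) y) < 4 * \<epsilon>"
      using dist_triangle2[of "(f ^^ i) x" "(f ^^ i) y" "(f ^^ i) (c x)"] by linarith
  next
    fix x j assume x: "x \<in> Dom (n - 1)" "1 \<le> j" "x \<in> Dom j" "(f ^^ j) x \<in> Dom (n - 1)" "c x \<in> M"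
    have "c x \<notin> E" using x(5) disj by blast
    then have "G (c x) \<subseteq> U (c x)" by (auto simp: G_def)
    then show "c ((f ^^ j) x) \<noteq> c x"
      using c(2)[OF x(1)] c(2)[OF x(4)] no_return[of "c x" j x] x M(1) by (metis subsetD)
  qed
qed

end
section \<open>Counting itineraries\<close>

text \<open>
  A point of \<open>A\<close> is encoded by the labels of its first \<open>N div n\<close> blocks and by the positions of the
  remaining fewer than \<open>n\<close> points of the orbit relative to a finite cover of \<open>X\<close> by \<open>2\<epsilon>\<close>-balls. Points
  with the same code stay within \<open>4\<epsilon>\<close>, so the code is injective on separated sets. The remainder is
  treated separately because orbits of length \<open>N\<close> need not extend to the next multiple of \<open>n\<close>.
\<close>

lemma (in clopen_partial_map) card_separated_le:
  assumes n: "1 \<le> n" and \<epsilon>: "0 < \<epsilon>" and E: "finite E" "E \<subseteq> Dom (n - 1)"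
    and span: "\<forall>x\<in>\<Omega> \<inter> Dom (n - 1). \<exists>e\<in>E. \<forall>i<n. dist ((f ^^ i) x) ((f ^^ i) e) \<le> \<epsilon>"
  shows "\<exists>m Q. 1 \<le> Q \<and> (\<forall>N A. (m + 1) * n \<le> N \<longrightarrow> A \<subseteq> Dom (N - 1) \<longrightarrow>
    (\<forall>x\<in>A. \<forall>y\<in>A. x \<noteq> y \<longrightarrow> (\<exists>i<N. 4 * \<epsilon> < dist ((f ^^ i) x) ((f ^^ i) y))) \<longrightarrow>
    finite A \<and> card A \<le> (N div n + 1) ^ m * card E ^ (N div n) * Q)"
proof -
  obtain M c where M: "finite M" "E \<inter> M = {}"
    and c: "\<And>x. x \<in> Dom (n - 1) \<Longrightarrow> c x \<in> E \<union> M"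
    and close: "\<And>x y i. \<lbrakk>x \<in> Dom (n - 1); y \<in> Dom (n - 1); c x = c y; i < n\<rbrakk>
        \<Longrightarrow> dist ((f ^^ i) x) ((f ^^ i) y) < 4 * \<epsilon>"
    and once: "\<And>x j. \<lbrakk>x \<in> Dom (n - 1); 1 \<le> j; x \<in> Dom j; (f ^^ j) x \<in> Dom (n - 1); c x \<in> M\<rbrakk>
        \<Longrightarrow> c ((f ^^ j) x) \<noteq> c x"
    using finite_labelling_of_blocks[OF n \<epsilon> E(2) span] by blast
  have "X \<subseteq> (\<Union>p\<in>X. ball p (2 * \<epsilon>))" using \<epsilon> by auto
  then obtain P where P: "finite P" "X \<subseteq> (\<Union>p\<in>P. ball p (2 * \<epsilon>))"
    by (rule compactE_image[OF compact_X open_ball])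
  have "\<exists>p. p \<in> P \<and> dist p x < 2 * \<epsilon>" if "x \<in> X" for x
    using subsetD[OF P(2) that] by auto
  then obtain t where t: "\<And>x. x \<in> X \<Longrightarrow> t x \<in> P" "\<And>x. x \<in> X \<Longrightarrow> dist (t x) x < 2 * \<epsilon>"
    by metis
  \<comment> \<open>the successor keeps \<open>Q\<close> positive and monotone in the length of the remainder even if \<open>P\<close> is empty\<close>
  define Q where "Q = Suc (card P) ^ n"
  have bound: "finite A \<and> card A \<le> (N div n + 1) ^ card M * card E ^ (N div n) * Q"
    if N: "(card M + 1) * n \<le> N" and A: "A \<subseteq> Dom (N - 1)"
      and sep: "\<And>x y. \<lbrakk>x \<in> A; y \<in> A; x \<noteq> y\<rbrakk> \<Longrightarrow> \<exists>i<N. 4 * \<epsilon> < dist ((f ^^ i) x) ((f ^^ i) y)"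
    for N A
  proof -
    define k where "k = N div n"
    have kn: "k * n \<le> N" unfolding k_def by (simp add: mult.commute)
    have tail: "N - k * n \<le> n"
      using n mod_less_divisor[of n N] by (simp add: k_def minus_div_mult_eq_mod)
    have k: "card M < k"
      using div_le_mono[OF N, of n] n by (simp add: k_def)
    have in_Dom: "x \<in> Dom i" if "x \<in> A" "i < N" for x i
    proof -
      have "i \<le> N - 1" using that(2) by simp
      then show ?thesis using A that(1) Dom_antimono by blast
    qed
    have block: "(f ^^ (j * n)) x \<in> Dom (n - 1)" if "x \<in> A" "j < k" for x j
    proof -
      have "(j + 1) * n \<le> k * n" using that(2) by (intro mult_right_mono) auto
      then have "j * n + (n - 1) < N" using kn n by (simp add: algebra_simps)
      then show ?thesis using in_Dom[OF that(1)] Dom_add_iff by blast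
    qed
    define I where "I = {g \<in> {..<k} \<rightarrow>\<^sub>E E \<union> M. inj_on g {j. j < k \<and> g j \<in> M}}"
    define word where "word x = (\<lambda>j\<in>{..<k}. c ((f ^^ (j * n)) x))" for x
    define rest where "rest x = (\<lambda>i\<in>{k * n..<N}. t ((f ^^ i) x))" for x
    have word_in: "word x \<in> I" if x: "x \<in> A" for x
    proof -
      \<comment> \<open>equal labels in blocks \<open>j\<close> and \<open>j'\<close> would be a return after \<open>(j' - j) * n\<close> steps\<close>
      have "word x j \<noteq> word x j'" if j: "j < j'" "j' < k" and w: "word x j \<in> M" for j j'
      proof -
        let ?y = "(f ^^ (j * n)) x" and ?d = "(j' - j) * n"
        have eq: "j' * n = j * n + ?d" using j by (simp add: diff_mult_distrib)
        have ret: "(f ^^ (j' * n)) x = (f ^^ ?d) ?y"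
          using funpow_add_apply[of "j * n" ?d f x] by (subst eq)
        have "(j' + 1) * n \<le> k * n" using j by (intro mult_right_mono) auto
        then have "j' * n < N" using kn n by (simp add: algebra_simps)
        then have "j * n + ?d < N" using eq by linarith
        then have "x \<in> Dom (j * n + ?d)" by (rule in_Dom[OF x])
        then have "?y \<in> Dom ?d" using Dom_add_iff by blast
        moreover have "1 \<le> ?d" using j n by simp
        moreover have "?y \<in> Dom (n - 1)" "(f ^^ ?d) ?y \<in> Dom (n - 1)"
          using block[OF x, of j] block[OF x, of j'] j unfolding ret by simp_all
        ultimately have "c ((f ^^ ?d) ?y) \<noteq> c ?y"
          using w j by (intro once) (auto simp: word_def)
        then show ?thesis using j ret by (simp add: word_def)
      qed
      then have "inj_on (word x) {j. j < k \<and> word x j \<in> M}"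
        by (intro linorder_inj_onI) auto
      moreover have "word x \<in> {..<k} \<rightarrow>\<^sub>E E \<union> M"
        using c block[OF x] by (auto simp: word_def)
      ultimately show ?thesis by (simp add: I_def)
    qed
    have rest_in: "rest x \<in> {k * n..<N} \<rightarrow>\<^sub>E P" if x: "x \<in> A" for x
    proof -
      have "(f ^^ i) x \<in> X" if "i < N" for i
        using in_Dom[OF x that] Dom_add_iff[of x i 0] by simp
      then show ?thesis using t(1) by (auto simp: rest_def)
    qed
    have inj: "inj_on (\<lambda>x. (word x, rest x)) A"
    proof (rule inj_onI, rule ccontr)
      fix x y assume xy: "x \<in> A" "y \<in> A" "(word x, rest x) = (word y, rest y)" "x \<noteq> y"
      then obtain i where i: "i < N" "4 * \<epsilon> < dist ((f ^^ i) x) ((f ^^ i) y)" using sep by blast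
      show False
      proof (cases "i < k * n")
        case True
        define j where "j = i div n"
        have j: "j < k" using True n by (simp add: j_def less_mult_imp_div_less)
        have r: "i mod n < n" using n by simp
        have split: "(f ^^ i) z = (f ^^ (i mod n)) ((f ^^ (j * n)) z)" for z
          using funpow_add_apply[of "i div n * n" "i mod n" f z] by (simp add: j_def)
        have "c ((f ^^ (j * n)) x) = c ((f ^^ (j * n)) y)"
          using xy(3) j by (auto simp: word_def dest: fun_cong[of _ _ j])
        then show False
          using close[OF block[OF xy(1) j] block[OF xy(2) j] _ r] i(2) unfolding split by simp
      next
        case False
        have X: "(f ^^ i) x \<in> X" "(f ^^ i) y \<in> X"
          using in_Dom[OF xy(1) i(1)] in_Dom[OF xy(2) i(1)] Dom_add_iff[of x i 0] Dom_add_iff[of y i 0]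
          by simp_all
        have "rest x i = rest y i" using xy(3) by simp
        then have "t ((f ^^ i) x) = t ((f ^^ i) y)"
          using False i(1) by (simp add: rest_def)
        then have "dist (t ((f ^^ i) x)) ((f ^^ i) y) < 2 * \<epsilon>"
          using t(2)[OF X(2)] by simp
        then show False
          using t(2)[OF X(1)] i(2)
            dist_triangle3[of "(f ^^ i) x" "(f ^^ i) y" "t ((f ^^ i) x)"] by linarith
      qed
    qed
    have sub: "(\<lambda>x. (word x, rest x)) ` A \<subseteq> I \<times> ({k * n..<N} \<rightarrow>\<^sub>E P)"
      using word_in rest_in by auto
    have "finite I"
      unfolding I_def using E(1) M(1) by (intro finite_subset[OF _ finite_PiE[of "{..<k}" "\<lambda>_. E \<union> M"]]) auto
    then have fin: "finite (I \<times> ({k * n..<N} \<rightarrow>\<^sub>E P))"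
      using P(1) by (auto intro: finite_PiE)
    have "card ({k * n..<N} \<rightarrow>\<^sub>E P) = card P ^ (N - k * n)"
      by (simp add: card_funcsetE)
    also have "\<dots> \<le> Suc (card P) ^ (N - k * n)" by (intro power_mono) auto
    also have "\<dots> \<le> Q" unfolding Q_def using tail by (intro power_increasing) auto
    finally have tails: "card ({k * n..<N} \<rightarrow>\<^sub>E P) \<le> Q" .
    have "card A \<le> card I * card ({k * n..<N} \<rightarrow>\<^sub>E P)"
      using card_inj_on_le[OF inj sub fin] by (simp add: card_cartesian_product)
    also have "\<dots> \<le> ((k + 1) ^ card M * card E ^ k) * Q"
      using card_words_with_rare_letters[OF E(1) M k] tails unfolding I_def by (intro mult_mono) auto
    finally show ?thesis
      using inj_on_finite[OF inj sub fin] unfolding k_def by simp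
  qed
  have "1 \<le> Q" by (simp add: Q_def)
  then show ?thesis using bound by (intro exI[of _ "card M"] exI[of _ Q] conjI allI impI) auto
qed

section \<open>Comparing the two entropies\<close>

context clopen_partial_map
begin

text \<open>
  On \<open>\<Omega>\<close> both systems have the same iterated metrics, and relatively closed subsets of \<open>\<Omega>\<close> are
  closed in \<open>X\<close>.
\<close>

lemma ssep_restrict_le:
  assumes "K \<subseteq> \<Omega>"
  shows "ssep \<Omega> (D \<inter> \<Omega>) f n \<epsilon> K \<le> ssep X D f n \<epsilon> K"
proof -
  have "sep \<Omega> (D \<inter> \<Omega>) f n \<epsilon> (K \<inter> F) \<le> ssep X D f n \<epsilon> K"
    if F: "closedin (top_of_set \<Omega>) F" "F \<subseteq> \<Omega> \<inter> Dom (n - 1)" for F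
  proof -
    have "dist_iter \<Omega> (D \<inter> \<Omega>) f n x y = dist_iter X D f n x y" if "x \<in> \<Omega>" "y \<in> \<Omega>" for x y
      using that by (simp add: dist_iter_def Dom_restrict)
    then have "separated \<Omega> (D \<inter> \<Omega>) f n \<epsilon> (K \<inter> F) A \<Longrightarrow> separated X D f n \<epsilon> (K \<inter> F) A" for A
      using assms by (auto simp: separated_def) (metis subsetD)
    then have "sep \<Omega> (D \<inter> \<Omega>) f n \<epsilon> (K \<inter> F) \<le> sep X D f n \<epsilon> (K \<inter> F)"
      unfolding sep_def by (intro SUP_subset_mono) auto
    also have "\<dots> \<le> ssep X D f n \<epsilon> K"
      unfolding ssep_def using F closedin_trans[OF F(1) closedin_nonwandering_set]
      by (intro SUP_upper) auto
    finally show ?thesis .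
  qed
  then show ?thesis
    unfolding ssep_def[of \<Omega>] Dom_restrict by (intro SUP_least) auto
qed

text \<open>
  A separated set of maximal cardinality is spanning, since any point that it misses could be added.
\<close>

lemma maximal_separated_in_nonwandering:
  assumes n: "1 \<le> n" and \<epsilon>: "0 < \<epsilon>" and s: "ssep \<Omega> (D \<inter> \<Omega>) f n \<epsilon> \<Omega> = enat s"
  obtains E where "finite E" "E \<subseteq> \<Omega> \<inter> Dom (n - 1)" "card E \<le> s"
    "\<forall>x\<in>\<Omega> \<inter> Dom (n - 1). \<exists>e\<in>E. \<forall>i<n. dist ((f ^^ i) x) ((f ^^ i) e) \<le> \<epsilon>"
proof -
  let ?S = "\<Omega> \<inter> Dom (n - 1)"
  let ?sepd = "separated \<Omega> (D \<inter> \<Omega>) f n \<epsilon> ?S"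
  have "closedin (top_of_set \<Omega>) ?S"
    using closedin_Dom[of "n - 1"] by (auto simp: closedin_closed nonwandering_set_def)
  then have "sep \<Omega> (D \<inter> \<Omega>) f n \<epsilon> (\<Omega> \<inter> ?S) \<le> enat s"
    unfolding s[symmetric] ssep_def Dom_restrict by (intro SUP_upper) auto
  then have "enat_card A \<le> enat s" if "?sepd A" for A
    using that unfolding sep_def by (simp add: SUP_le_iff)
  then have fin: "finite A \<and> card A \<le> s" if "?sepd A" for A
    using that by (fastforce simp: enat_card_def split: if_splits)
  have "?sepd {}" by (simp add: separated_def)
  then obtain E where E: "?sepd E" and max: "\<And>A. ?sepd A \<Longrightarrow> card A \<le> card E"
    using ex_has_greatest_nat[of ?sepd "{}" card "Suc s"] fin by (auto simp: less_Suc_eq_le)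
  have less_iff: "\<epsilon> < dist_iter \<Omega> (D \<inter> \<Omega>) f n x y \<longleftrightarrow> (\<exists>i<n. \<epsilon> < dist ((f ^^ i) x) ((f ^^ i) y))"
    if "x \<in> ?S" "y \<in> ?S" for x y
    using that by (intro less_dist_iter_iff[OF _ n]) (simp_all add: Dom_restrict)
  have ES: "E \<subseteq> ?S" using E by (simp add: separated_def)
  show thesis
  proof (rule that)
    show "finite E" "E \<subseteq> ?S" "card E \<le> s" using fin[OF E] ES by auto
    show "\<forall>x\<in>?S. \<exists>e\<in>E. \<forall>i<n. dist ((f ^^ i) x) ((f ^^ i) e) \<le> \<epsilon>"
    proof (rule ballI, rule ccontr)
      fix x assume x: "x \<in> ?S"
      assume "\<not> (\<exists>e\<in>E. \<forall>i<n. dist ((f ^^ i) x) ((f ^^ i) e) \<le> \<epsilon>)"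
      then have far: "\<exists>i<n. \<epsilon> < dist ((f ^^ i) x) ((f ^^ i) e)" if "e \<in> E" for e
        using that by (meson not_le)
      have "x \<notin> E" using far \<epsilon> by fastforce
      have "\<epsilon> < dist_iter \<Omega> (D \<inter> \<Omega>) f n x e \<and> \<epsilon> < dist_iter \<Omega> (D \<inter> \<Omega>) f n e x" if "e \<in> E" for e
        using far[OF that] that ES x less_iff[of x e] less_iff[of e x] by (auto simp: dist_commute)
      then have "?sepd (insert x E)"
        using E x by (auto simp: separated_def)
      then show False using max \<open>x \<notin> E\<close> fin[OF E] by fastforce
    qed
  qed
qed

text \<open>
  The decisive inequality: a single block length \<open>n\<close> in \<open>\<Omega>\<close> controls the growth of the whole system.
  If the count on \<open>\<Omega>\<close> is infinite there is nothing to show; otherwise a maximal separated set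
  of \<open>\<Omega>\<close> serves as the labels of the nonwandering blocks.
\<close>

lemma entropy_eps_le_one_block:
  assumes n: "1 \<le> n" and \<epsilon>: "0 < \<epsilon>"
  shows "entropy_eps X D f (4 * \<epsilon>) K \<le> ereal (1 / real n) * log_enat (ssep \<Omega> (D \<inter> \<Omega>) f n \<epsilon> \<Omega>)"
proof (cases "ssep \<Omega> (D \<inter> \<Omega>) f n \<epsilon> \<Omega>")
  case infinity
  have "ereal (1 / real n) * \<infinity> = \<infinity>" using n by (subst times_ereal.simps) simp
  then show ?thesis unfolding infinity log_enat_def by simp
next
  case (enat s)
  obtain E where E: "finite E" "E \<subseteq> \<Omega> \<inter> Dom (n - 1)" "card E \<le> s"
    and span: "\<forall>x\<in>\<Omega> \<inter> Dom (n - 1). \<exists>e\<in>E. \<forall>i<n. dist ((f ^^ i) x) ((f ^^ i) e) \<le> \<epsilon>"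
    by (rule maximal_separated_in_nonwandering[OF n \<epsilon> enat])
  have "E \<subseteq> Dom (n - 1)" using E(2) by blast
  from card_separated_le[OF n \<epsilon> E(1) this span] obtain m Q where Q: "1 \<le> Q"
    and bound: "\<forall>N A. (m + 1) * n \<le> N \<longrightarrow> A \<subseteq> Dom (N - 1) \<longrightarrow>
      (\<forall>x\<in>A. \<forall>y\<in>A. x \<noteq> y \<longrightarrow> (\<exists>i<N. 4 * \<epsilon> < dist ((f ^^ i) x) ((f ^^ i) y))) \<longrightarrow>
      finite A \<and> card A \<le> (N div n + 1) ^ m * card E ^ (N div n) * Q"
    by (elim exE conjE) (rule that)
  have "ssep X D f N (4 * \<epsilon>) K \<le> enat ((N div n + 1) ^ m * card E ^ (N div n) * Q)"
    if N: "(m + 1) * n \<le> N" for N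
  proof -
    have N1: "1 \<le> N" using N n by simp
    have "enat_card A \<le> enat ((N div n + 1) ^ m * card E ^ (N div n) * Q)"
      if F: "F \<subseteq> Dom (N - 1)" and A: "separated X D f N (4 * \<epsilon>) (K \<inter> F) A" for F A
    proof -
      have "A \<subseteq> Dom (N - 1)" using F A by (auto simp: separated_def)
      moreover have "\<exists>i<N. 4 * \<epsilon> < dist ((f ^^ i) x) ((f ^^ i) y)" if "x \<in> A" "y \<in> A" "x \<noteq> y" for x y
      proof -
        have xy: "x \<in> Dom (N - 1)" "y \<in> Dom (N - 1)"
          using that \<open>A \<subseteq> Dom (N - 1)\<close> by auto
        have "\<forall>x\<in>A. \<forall>y\<in>A. x \<noteq> y \<longrightarrow> 4 * \<epsilon> < dist_iter X D f N x y"
          using A by (simp add: separated_def)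
        from this[rule_format, OF that] show ?thesis
          unfolding less_dist_iter_iff[OF D_subset N1 xy] .
      qed
      ultimately have "finite A \<and> card A \<le> (N div n + 1) ^ m * card E ^ (N div n) * Q"
        by (rule bound[rule_format, OF N])
      then show ?thesis by (simp add: enat_card_def)
    qed
    then show ?thesis unfolding ssep_def sep_def by (intro SUP_least) auto
  qed
  then have "entropy_eps X D f (4 * \<epsilon>) K \<le> ereal (1 / real n) * log_enat (enat (card E))"
    unfolding entropy_eps_def by (rule limsup_log_itinerary_bound[OF n Q])
  also have "\<dots> \<le> ereal (1 / real n) * log_enat (enat s)"
    using E(3) by (intro ereal_mult_left_mono log_enat_mono) auto
  finally show ?thesis by (simp add: enat)
qed

lemma entropy_eps_le:
  assumes "0 < \<epsilon>"
  shows "entropy_eps X D f (4 * \<epsilon>) K \<le> entropy_eps \<Omega> (D \<inter> \<Omega>) f \<epsilon> \<Omega>"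
  unfolding entropy_eps_def[of \<Omega>]
  using assms by (intro le_Limsup eventually_mono[OF eventually_ge_at_top[of 1]] entropy_eps_le_one_block) auto

lemma entropy_eq_entropy_nonwandering: "dr_entropy X D f = dr_entropy \<Omega> (D \<inter> \<Omega>) f"
proof (rule antisym)
  have "compact \<Omega>" using closedin_compact[OF compact_X closedin_nonwandering_set] .
  have "entropy_eps X D f \<epsilon> K \<le> dr_entropy \<Omega> (D \<inter> \<Omega>) f" if "0 < \<epsilon>" for \<epsilon> K
  proof -
    have "entropy_eps X D f \<epsilon> K \<le> entropy_eps \<Omega> (D \<inter> \<Omega>) f (\<epsilon> / 4) \<Omega>"
      using entropy_eps_le[of "\<epsilon> / 4" K] that by simp
    also have "\<dots> \<le> entropy_on \<Omega> (D \<inter> \<Omega>) f \<Omega>"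
      unfolding entropy_on_eq_SUP using that by (intro SUP_upper) auto
    also have "\<dots> \<le> dr_entropy \<Omega> (D \<inter> \<Omega>) f"
      unfolding dr_entropy_def using \<open>compact \<Omega>\<close> by (intro SUP_upper) auto
    finally show ?thesis .
  qed
  then show "dr_entropy X D f \<le> dr_entropy \<Omega> (D \<inter> \<Omega>) f"
    unfolding dr_entropy_def[of X] entropy_on_eq_SUP[of X] by (intro SUP_least) auto
next
  have "entropy_on \<Omega> (D \<inter> \<Omega>) f K \<le> dr_entropy X D f" if K: "K \<subseteq> \<Omega>" "compact K" for K
  proof -
    have "entropy_on \<Omega> (D \<inter> \<Omega>) f K \<le> entropy_on X D f K"
      unfolding entropy_on_eq_SUP using K by (intro SUP_mono') (auto intro!: entropy_eps_mono ssep_restrict_le)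
    also have "\<dots> \<le> dr_entropy X D f"
      unfolding dr_entropy_def using K by (intro SUP_upper) (auto simp: nonwandering_set_def)
    finally show ?thesis .
  qed
  then show "dr_entropy \<Omega> (D \<inter> \<Omega>) f \<le> dr_entropy X D f"
    unfolding dr_entropy_def[of \<Omega>] by (intro SUP_least) auto
qed

end

theorem theorem4p10:
  fixes X D :: "'a::metric_space set" and \<sigma> :: "'a \<Rightarrow> 'a"
  assumes "compact X"
    and "dr_system X D \<sigma>"
    and "openin (top_of_set X) D"
    and "closedin (top_of_set X) D"
  defines "\<Omega> \<equiv> nonwandering_set X D \<sigma>"
  shows "dr_entropy X D \<sigma> = dr_entropy \<Omega> (D \<inter> \<Omega>) \<sigma>"
proof -
  interpret clopen_partial_map X D \<sigma>
  proof
    show "continuous_on D \<sigma>"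
      using assms(2) local_homeomorphism_onto_imp_continuous_on by (auto simp: dr_system_def)
    have "openin (top_of_set X) (\<sigma> ` D)" using assms(2) by (simp add: dr_system_def)
    then show "\<sigma> ` D \<subseteq> X" by (rule openin_imp_subset)
  qed (use assms in auto)
  show ?thesis unfolding \<Omega>_def by (rule entropy_eq_entropy_nonwandering)
qed

end
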